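(* For every $n\geq 1$, $M_\Theta(n)\leq 2n+1$.
   Context: $\Theta$-property: a subset $S\subseteq\mathbb{Z}_2^n$ has the $\Theta$-property if for any three pairwise disjoint subsets of $S$ whose element sums are equal, at least two of the three subsets have even size. (An empty subset is allowed; its sum is $0$.) $M_\Theta(n)$ denotes the maximum of $|S|$ over all subsets $S\subseteq\mathbb{Z}_2^n$ that generate $\mathbb{Z}_2^n$ and have the $\Theta$-property; here $S$ is allowed to contain $0$. *)

theory Defs
  imports "HOL-Analysis.Cartesian_Space" "HOL-Library.Z2"
begin

text \<open>
  The group \<open>Z_2^n\<close> is the type \<^typ>\<open>bit ^ 'n\<close> with \<open>n = CARD('n)\<close>, so \<open>n \<ge> 1\<close> holds by construction.
\<close>

definition theta_property :: "(bit ^ 'n::finite) set \<Rightarrow> bool" where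
  "theta_property S \<longleftrightarrow>
     (\<forall>A B C. A \<subseteq> S \<and> B \<subseteq> S \<and> C \<subseteq> S \<and>
        A \<inter> B = {} \<and> A \<inter> C = {} \<and> B \<inter> C = {} \<and>
        \<Sum>A = \<Sum>B \<and> \<Sum>B = \<Sum>C \<longrightarrow>
        (even (card A) \<and> even (card B)) \<or>
        (even (card A) \<and> even (card C)) \<or>
        (even (card B) \<and> even (card C)))"

text \<open>
  Over \<open>bit\<close> every additive subgroup is closed under scalars, so the linear span of \<open>S\<close>
  is the subgroup generated by \<open>S\<close>. The set whose maximum is taken is finite, because the type
  \<^typ>\<open>bit ^ 'n\<close> has finitely many elements, and nonempty, because any basis generates and has the
  property: in a linearly independent set the only disjoint subsets with equal sums are empty.
\<close>

definition M_Theta :: "'n::finite itself \<Rightarrow> nat" where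
  "M_Theta _ = Max {card S | S :: (bit ^ 'n) set. vec.span S = UNIV \<and> theta_property S}"

end

theory Submission
  imports Defs
begin

text \<open>
  Subsets of \<open>S\<close> with sum \<open>0\<close> form a binary linear code of length \<open>|S|\<close> with at least
  \<open>2 ^ |S| / 2 ^ n\<close> words. For two such words \<open>X\<close> and \<open>Y\<close>, the sets \<open>X \<inter> Y\<close>, \<open>X - Y\<close>, \<open>Y - X\<close>
  are disjoint with equal sums, and the \<open>\<Theta>\<close>-property says exactly that
  \<open>|X \<inter> Y|\<close> and \<open>|X| |Y|\<close> have the same parity. Appending a parity bit thus makes the code
  self-orthogonal of length \<open>|S| + 1\<close>, so it has at most \<open>2 ^ ((|S| + 1) / 2)\<close> words.
\<close>

text \<open>Orthogonality of the characters \<open>Y \<mapsto> (-1) ^ card (X \<inter> Y)\<close> of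
  the group \<open>Pow T\<close> under symmetric difference. The sum factors over the points of
  \<open>T\<close>, and the factor at a point where \<open>X\<close> and \<open>X'\<close> differ is
  \<open>-1 + 1 = 0\<close>.\<close>

lemma sum_Pow_character:
  assumes "finite T" "X \<subseteq> T" "X' \<subseteq> T"
  shows "(\<Sum>Y\<in>Pow T. (-1::int) ^ card (X \<inter> Y) * (-1) ^ card (X' \<inter> Y)) =
         (if X = X' then 2 ^ card T else 0)"
proof -
  define s where "s Z t = (if t \<in> Z then -1 else 1 :: int)" for Z :: "'a set" and t
  have pw: "(-1::int) ^ card (Z \<inter> Y) = prod (s Z) Y" if "Y \<subseteq> T" for Y Z
  proof -
    have "finite Y" using that assms(1) finite_subset by blast
    then show ?thesis
      by (simp add: s_def prod.If_cases Int_commute)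
  qed
  \<comment> \<open>The empty-looking factor over \<open>T - Y\<close> gives the sum the shape of an
    expanded product of binomials.\<close>
  have "(\<Sum>Y\<in>Pow T. (-1::int) ^ card (X \<inter> Y) * (-1) ^ card (X' \<inter> Y))
      = (\<Sum>Y\<in>Pow T. (\<Prod>t\<in>Y. s X t * s X' t) * (\<Prod>t\<in>T - Y. 1))"
    by (intro sum.cong refl) (simp add: pw prod.distrib)
  also have "\<dots> = (\<Prod>t\<in>T. s X t * s X' t + 1)"
    by (rule prod_add[OF assms(1), symmetric])
  also have "\<dots> = (if X = X' then 2 ^ card T else 0)"
  proof (cases "X = X'")
    case True
    have "(\<Prod>t\<in>T. s X t * s X t + 1) = (\<Prod>t\<in>T. 2)"
      by (intro prod.cong) (auto simp: s_def)
    with True show ?thesis by simp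
  next
    case False
    then obtain t where "t \<in> T" "t \<in> X \<longleftrightarrow> t \<notin> X'"
      using assms by blast
    then have "\<exists>t\<in>T. s X t * s X' t + 1 = 0"
      by (intro bexI[of _ t]) (auto simp: s_def)
    with False assms(1) show ?thesis by simp
  qed
  finally show ?thesis .
qed

text \<open>Parseval's identity for the character sum of \<open>K\<close>, which equals \<open>|K|\<close> at every word of \<open>K\<close>.\<close>

lemma card_self_orthogonal:
  assumes "finite T" "K \<subseteq> Pow T"
    and orth: "\<And>X Y. X \<in> K \<Longrightarrow> Y \<in> K \<Longrightarrow> even (card (X \<inter> Y))"
  shows "(card K)\<^sup>2 \<le> 2 ^ card T"
proof (cases "K = {}")
  case False
  have finK: "finite K" using assms(1,2) by (simp add: finite_subset)
  define h where "h Y = (\<Sum>X\<in>K. (-1::int) ^ card (X \<inter> Y))" for Y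
  have "int (card K) * (int (card K))\<^sup>2 = (\<Sum>Y\<in>K. (h Y)\<^sup>2)"
    using orth by (simp add: h_def)
  also have "\<dots> \<le> (\<Sum>Y\<in>Pow T. (h Y)\<^sup>2)"
    by (rule sum_mono2) (use assms in auto)
  also have "\<dots> = (\<Sum>Y\<in>Pow T. \<Sum>X\<in>K. \<Sum>X'\<in>K. (-1) ^ card (X \<inter> Y) * (-1) ^ card (X' \<inter> Y))"
    by (simp add: h_def power2_eq_square sum_product)
  also have "\<dots> = (\<Sum>X\<in>K. \<Sum>X'\<in>K. \<Sum>Y\<in>Pow T. (-1) ^ card (X \<inter> Y) * (-1) ^ card (X' \<inter> Y))"
    by (subst sum.swap, rule sum.cong[OF refl], rule sum.swap)
  also have "\<dots> = (\<Sum>X\<in>K. \<Sum>X'\<in>K. if X = X' then 2 ^ card T else 0)"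
    by (intro sum.cong refl sum_Pow_character) (use assms in auto)
  also have "\<dots> = int (card K) * 2 ^ card T"
    using finK by simp
  finally have "int (card K) * int ((card K)\<^sup>2) \<le> int (card K) * int (2 ^ card T)"
    by simp
  moreover have "card K > 0" using False finK by (simp add: card_gt_0_iff)
  ultimately show ?thesis
    by (metis mult_le_cancel_left_pos of_nat_0_less_iff of_nat_le_iff)
qed simp

lemma card_UNIV_bit_vec: "CARD(bit ^ 'n::finite) = 2 ^ CARD('n)"
proof -
  have "(UNIV :: bit set) = {0, 1}"
    using bit_not_zero_iff by blast
  then have "CARD(bit) = card {0, 1 :: bit}" by (rule arg_cong)
  then show ?thesis by (simp add: numeral_2_eq_2)
qed

lemma finite_UNIV_bit_vec: "finite (UNIV :: (bit ^ 'n::finite) set)"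
  by (rule card_ge_0_finite) (simp add: card_UNIV_bit_vec del: CARD_vec)

lemma finite_bit_vec: "finite (A :: (bit ^ 'n::finite) set)"
  by (rule finite_subset[OF subset_UNIV finite_UNIV_bit_vec])

lemma bit_vec_add_self: "(v :: bit ^ 'n) + v = 0"
  by (simp add: vec_eq_iff)

lemma bit_vec_add_eq_0_iff: "(v :: bit ^ 'n) + w = 0 \<longleftrightarrow> v = w"
proof -
  have "v $ i + w $ i = 0 \<longleftrightarrow> v $ i = w $ i" for i
    by (cases "v $ i"; cases "w $ i") simp_all
  then show ?thesis by (simp add: vec_eq_iff)
qed

text \<open>Makes \<open>X \<mapsto> \<Sum>X\<close> a homomorphism for symmetric difference: the
  common part is counted twice and cancels in characteristic 2.\<close>

lemma sum_sym_diff_bit_vec: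
  fixes X Y :: "(bit ^ 'n::finite) set"
  shows "\<Sum>((X - Y) \<union> (Y - X)) = \<Sum>X + \<Sum>Y"
proof -
  have split: "\<Sum>X = \<Sum>(X \<inter> Y) + \<Sum>(X - Y)" "\<Sum>Y = \<Sum>(X \<inter> Y) + \<Sum>(Y - X)"
    by (rule sum.Int_Diff[OF finite_bit_vec])
      (rule sum.Int_Diff[OF finite_bit_vec, of _ Y X, unfolded Int_commute[of Y X]])
  have union: "\<Sum>((X - Y) \<union> (Y - X)) = \<Sum>(X - Y) + \<Sum>(Y - X)"
    by (rule sum.union_disjoint) (auto simp: finite_bit_vec)
  have cancel: "(a + b) + (a + c) = b + c" for a b c :: "bit ^ 'n"
  proof -
    have "(a + b) + (a + c) = (a + a) + (b + c)" by (simp only: ac_simps)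
    then show ?thesis by (simp only: bit_vec_add_self add_0)
  qed
  show ?thesis by (simp only: split union cancel)
qed

text \<open>Pigeonhole: \<open>Pow S\<close> splits into at most \<open>2 ^ CARD('n)\<close>
  nonempty fibres of the sum map, none larger than the fibre over \<open>0\<close>.\<close>

lemma card_Pow_le_zero_sum_subsets:
  fixes S :: "(bit ^ 'n::finite) set"
  shows "2 ^ card S \<le> card {X. X \<subseteq> S \<and> \<Sum>X = 0} * 2 ^ CARD('n)"
proof -
  let ?K = "{X. X \<subseteq> S \<and> \<Sum>X = 0}"
  let ?F = "\<lambda>v. {X. X \<subseteq> S \<and> \<Sum>X = v}"
  have finK: "finite ?K" by (simp add: finite_bit_vec)
  have fibre: "card (?F v) \<le> card ?K" for v
  proof (cases "?F v = {}")
    case False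
    then obtain X0 where X0: "X0 \<subseteq> S" "\<Sum>X0 = v" by blast
    \<comment> \<open>Translation by a fixed member \<open>X0\<close> carries the fibre over
      \<open>v\<close> injectively into the fibre over \<open>0\<close>.\<close>
    let ?d = "\<lambda>X. (X - X0) \<union> (X0 - X)"
    have "inj_on ?d (?F v)" by (rule inj_onI) blast
    moreover have "?d ` ?F v \<subseteq> ?K"
      using X0 by (auto simp: sum_sym_diff_bit_vec bit_vec_add_self simp del: Un_Diff_cancel)
    ultimately show ?thesis using finK by (rule card_inj_on_le)
  qed (simp only: card.empty zero_le)
  have "2 ^ card S = card (\<Union>v. ?F v)"
    by (subst card_Pow[OF finite_bit_vec, symmetric], rule arg_cong[where f = card]) auto
  also have "\<dots> \<le> (\<Sum>v\<in>UNIV. card (?F v))"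
    by (rule card_UN_le[OF finite_UNIV_bit_vec])
  also have "\<dots> \<le> (\<Sum>v\<in>(UNIV :: (bit ^ 'n) set). card ?K)"
    by (rule sum_mono) (rule fibre)
  also have "\<dots> = card ?K * 2 ^ CARD('n)"
    by (simp add: card_UNIV_bit_vec del: CARD_vec)
  finally show ?thesis .
qed

lemma theta_property_parity_Int:
  fixes S :: "(bit ^ 'n::finite) set"
  assumes "theta_property S" "X \<subseteq> S" "Y \<subseteq> S" "\<Sum>X = 0" "\<Sum>Y = 0"
  shows "even (card (X \<inter> Y)) \<longleftrightarrow> even (card X) \<or> even (card Y)"
proof -
  have diff: "\<Sum>U = 0 \<Longrightarrow> \<Sum>(U \<inter> V) = \<Sum>(U - V)" for U V :: "(bit ^ 'n) set"
    unfolding sum.Int_Diff[OF finite_bit_vec, of "\<lambda>x. x" U V] bit_vec_add_eq_0_iff .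
  have sums: "\<Sum>(X \<inter> Y) = \<Sum>(X - Y)" "\<Sum>(X - Y) = \<Sum>(Y - X)"
    using diff[OF assms(4), of Y] diff[OF assms(5), of X, unfolded Int_commute[of Y X]]
    by (simp_all only:)
  have cards: "card X = card (X \<inter> Y) + card (X - Y)" "card Y = card (X \<inter> Y) + card (Y - X)"
    by (rule card_Int_Diff[OF finite_bit_vec])
      (rule card_Int_Diff[OF finite_bit_vec, of Y X, unfolded Int_commute[of Y X]])
  \<comment> \<open>If \<open>X \<inter> Y\<close> is odd, both differences are even, so
    \<open>X\<close> and \<open>Y\<close> are odd. If it is even, some difference is even, and so is
    the corresponding \<open>X\<close> or \<open>Y\<close>.\<close>
  have "(even (card (X \<inter> Y)) \<and> even (card (X - Y))) \<or>
        (even (card (X \<inter> Y)) \<and> even (card (Y - X))) \<or>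
        (even (card (X - Y)) \<and> even (card (Y - X)))"
    by (rule assms(1)[unfolded theta_property_def, rule_format])
      (intro conjI sums; use assms(2,3) in blast)
  then show ?thesis unfolding cards by auto
qed

lemma theta_property_card_le:
  fixes S :: "(bit ^ 'n::finite) set"
  assumes "theta_property S"
  shows "card S \<le> 2 * CARD('n) + 1"
proof -
  define K where "K = {X. X \<subseteq> S \<and> \<Sum>X = 0}"
  \<comment> \<open>\<open>None\<close> is the parity coordinate. It enters
    \<open>e X \<inter> e Y\<close> exactly when \<open>X\<close> and \<open>Y\<close> are both odd,
    which for words of \<open>K\<close> is when \<open>X \<inter> Y\<close> is odd.\<close>
  define e where "e X = Some ` X \<union> (if odd (card X) then {None} else {})" for X :: "(bit ^ 'n) set"
  let ?T = "insert None (Some ` S)"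
  have "inj_on e K"
  proof (rule inj_onI)
    fix X Y assume "e X = e Y"
    then have "Some -` e X = Some -` e Y" by simp
    then show "X = Y" by (auto simp: e_def split: if_splits)
  qed
  have "even (card (e X \<inter> e Y))" if "X \<in> K" "Y \<in> K" for X Y
  proof -
    have "e X \<inter> e Y = Some ` (X \<inter> Y) \<union> (if odd (card X) \<and> odd (card Y) then {None} else {})"
      by (auto simp: e_def)
    moreover have "card (Some ` (X \<inter> Y)) = card (X \<inter> Y)"
      by (rule card_image) simp
    ultimately show ?thesis
      using theta_property_parity_Int[OF assms, of X Y] that
      by (auto simp: K_def finite_bit_vec card_insert_if)
  qed
  then have "(card (e ` K))\<^sup>2 \<le> 2 ^ card ?T"
    by (intro card_self_orthogonal) (auto simp: finite_bit_vec e_def K_def split: if_splits)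
  moreover have "card ?T = card S + 1"
    by (simp add: finite_bit_vec card_image)
  ultimately have K: "(card K)\<^sup>2 \<le> 2 ^ (card S + 1)"
    using \<open>inj_on e K\<close> by (simp add: card_image)
  \<comment> \<open>Squaring the pigeonhole bound lets the bound on \<open>(card K)\<^sup>2\<close>
    be inserted without halving an exponent. The \<open>+ 1\<close> from the parity coordinate
    survives into the final bound.\<close>
  have "(2 ^ card S)\<^sup>2 \<le> (card K * 2 ^ CARD('n))\<^sup>2"
    using card_Pow_le_zero_sum_subsets[of S] by (intro power_mono) (simp_all add: K_def)
  also have "\<dots> \<le> 2 ^ (card S + 1) * (2 ^ CARD('n))\<^sup>2"
    using K by (simp add: power_mult_distrib)
  finally have "(2::nat) ^ (card S * 2) \<le> 2 ^ (card S + 1 + CARD('n) * 2)"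
    by (simp only: power_mult power_add)
  then have "card S * 2 \<le> card S + 1 + CARD('n) * 2"
    by (rule power_le_imp_le_exp[rotated]) simp
  then show ?thesis by linarith
qed

lemma independent_sum_eq_0_empty:
  fixes B :: "(bit ^ 'n::finite) set"
  assumes "vec.independent B" "X \<subseteq> B" "\<Sum>X = 0"
  shows "X = {}"
proof -
  have "(\<Sum>v\<in>X. 1 *s v) = 0" using assms(3) by (simp only: vec.scale_one)
  then show ?thesis
    using assms(1)[unfolded vec.independent_explicit_finite_subsets, rule_format,
        OF assms(2) finite_bit_vec, of "\<lambda>_. 1"] zero_neq_one by blast
qed

text \<open>Supplies a set over which the maximum is taken. In characteristic 2, disjoint sets with
  equal sums have a union of sum \<open>0\<close>, so by independence both are empty.\<close>

lemma independent_theta_property: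
  fixes B :: "(bit ^ 'n::finite) set"
  assumes "vec.independent B"
  shows "theta_property B"
proof -
  have "X = {} \<and> Y = {}" if "X \<subseteq> B" "Y \<subseteq> B" "X \<inter> Y = {}" "\<Sum>X = \<Sum>Y" for X Y
  proof -
    have "\<Sum>(X \<union> Y) = \<Sum>X + \<Sum>Y"
      using that by (intro sum.union_disjoint finite_bit_vec)
    then have "\<Sum>(X \<union> Y) = 0" using that by (simp add: bit_vec_add_self)
    with independent_sum_eq_0_empty[OF assms, of "X \<union> Y"] that show ?thesis by blast
  qed
  then show ?thesis unfolding theta_property_def by (metis card.empty even_zero)
qed

theorem theorem6p1:
  shows "M_Theta TYPE('n::finite) \<le> 2 * CARD('n) + 1"
proof -
  let ?C = "{card S | S :: (bit ^ 'n) set. vec.span S = UNIV \<and> theta_property S}"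
  have le: "\<And>k. k \<in> ?C \<Longrightarrow> k \<le> 2 * CARD('n) + 1"
    using theta_property_card_le by blast
  \<comment> \<open>\<open>Max\<close> is meaningful only on a finite nonempty set: the bound itself
    gives finiteness, and a basis gives a member.\<close>
  have "finite ?C"
    by (rule finite_subset[of _ "{..2 * CARD('n) + 1}"]) (use le in auto)
  moreover obtain B :: "(bit ^ 'n) set" where "vec.independent B" "UNIV \<subseteq> vec.span B"
    using vec.maximal_independent_subset[of UNIV] by metis
  then have "card B \<in> ?C"
    using independent_theta_property by blast
  ultimately show ?thesis
    unfolding M_Theta_def using le by (intro Max.boundedI) blast+
qed

end
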